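(* Suppose that the $\mathbb{N}$-based Smullyan model $M_{\mathbb{N}}$ satisfies FPT, i.e. for every $H\in\mathrm{Pred}$ there is $S\in\mathrm{Sent}^+$ such that $S\in\mathrm{True}_{M_{\mathbb{N}}}\iff HS\in\mathrm{True}_{M_{\mathbb{N}}}$. Then for any $v$-formula $\varphi_i(v)$ there exists an $\mathcal{L}_A$-sentence $\theta$ such that $\mathbb{N}\models\theta\leftrightarrow\varphi_i(\ulcorner\theta\urcorner)$.
   Context: Arithmetic. $\mathcal{L}_A$ is the language of first-order arithmetic, containing a function symbol for each primitive recursive function; $\mathbb{N}$ is also the standard $\mathcal{L}_A$-structure; $\overline{n}$ is the numeral of $n$. Fix a natural Gödel numbering; $\ulcorner\psi\urcorner$ is the Gödel number of $\psi$, and inside formulas also its numeral. Fix a variable $v$. A $v$-formula is an $\mathcal{L}_A$-formula with no free variables other than $v$ (possibly none); $\varphi_i(v)$ is the $v$-formula with Gödel number $i$; $\Gamma$ is the set of Gödel numbers of $v$-formulas; $\psi(t)$ is the result of substituting the term $t$ for $v$ in $\psi(v)$. $d$ is the primitive recursive function (and its function symbol) with $d(i)=\ulcorner\varphi_i(\overline{i})\urcorner$ if $i\in\Gamma$ and $d(i)=0$ otherwise. $\equiv$ is syntactic identity and $\neg^k$ is a string of $k$ negations. Frame. Let $\mathsf{n},\mathsf{r},a_i$ $(i\in\Gamma)$ be pairwise distinct symbols, $\Sigma=\{a_i: i\in\Gamma\}\cup\{\mathsf{n},\mathsf{r}\}$, $\Sigma^\ast$ the set of finite strings over $\Sigma$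 (including the empty string $\epsilon$), $\mathrm{Pred}=\{Xa_i: X\in\{\mathsf{n},\mathsf{r}\}^\ast, i\in\Gamma\}$, $\mathrm{Sent}=\{HX: H\in\mathrm{Pred}, X\in\Sigma^\ast\}$ (the decomposition $HX$ is unique), $\mathrm{Sent}^+=\mathrm{Sent}\setminus\mathrm{Pred}$. Map $I$ from $\mathrm{Pred}$ to $v$-formulas: $I(\mathsf{n}^k a_i)\equiv\neg^k\varphi_i(v)$; $I(\mathsf{n}^k\mathsf{r}\mathsf{n}^l a_i)\equiv\neg^{k+l}\varphi_i(d(v))$; $I(\mathsf{n}^k\mathsf{r}\mathsf{n}^l\mathsf{r}Y a_i)\equiv\neg^{k+l}\bot$ ($k,l\ge0$, $Y\in\{\mathsf{n},\mathsf{r}\}^\ast$). Map $J$ from $\mathrm{Sent}$ to $\mathcal{L}_A$-sentences, defined inductively for $H\in\mathrm{Pred}$, $X\in\Sigma^\ast$: if $X\in\mathrm{Pred}$, $J(HX)\equiv I(H)(\ulcorner I(X)(v)\urcorner)$; if $X\notin\mathrm{Sent}$, $J(a_iX)\equiv I(a_i)(0)$, $J(\mathsf{r}HX)\equiv\bot$, $J(\mathsf{n}HX)\equiv\neg J(HX)$; if $X\in\mathrm{Sent}^+$, $J(a_iX)\equiv I(a_i)(\ulcorner J(X)\urcorner)$, $J(\mathsf{r}HX)\equiv\bot$, $J(\mathsf{n}HX)\equiv\neg J(HX)$. Model. $M_{\mathbb{N}}=(\Sigma,\mathrm{Pred},\Phi_{\mathbb{N}})$ with $\Phi_{\mathbb{N}}(H)=\{X\in\Sigma^\ast: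 \mathbb{N}\models J(HX)\}$. $\mathrm{True}_{M_{\mathbb{N}}}=\{HX: H\in\mathrm{Pred}, X\in\Phi_{\mathbb{N}}(H)\}$. *)

theory Defs
  imports Main "HOL-Library.Nat_Bijection"
begin

section \<open>Primitive recursive functions\<close>

text \<open>
  Descriptions of primitive recursive functions. As usual in HOL, a description is interpreted on
  argument lists of any length (missing arguments count as 0), so together with a number \<open>n\<close> it
  describes an \<open>n\<close>-ary primitive recursive function, and every \<open>n\<close>-ary primitive recursive
  function arises in this way. \<open>PRec f g\<close> recurses on the first argument.
\<close>

datatype pr = PZero | PSucc | PProj nat | PComp pr "pr list" | PRec pr pr

definition arg :: "nat list \<Rightarrow> nat \<Rightarrow> nat" where
  "arg xs i = (if i < length xs then xs ! i else 0)"

fun pev :: "pr \<Rightarrow> nat list \<Rightarrow> nat" where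
  "pev PZero xs = 0"
| "pev PSucc xs = Suc (arg xs 0)"
| "pev (PProj i) xs = arg xs i"
| "pev (PComp f gs) xs = pev f (map (\<lambda>g. pev g xs) gs)"
| "pev (PRec f g) xs =
     rec_nat (pev f (tl xs)) (\<lambda>k r. pev g (k # r # tl xs)) (arg xs 0)"


section \<open>The language of arithmetic\<close>

text \<open>
  The \<open>n\<close>-ary function symbols are the descriptions \<open>p\<close>, each taken with the arity \<open>n\<close>; the term
  \<open>Fn p ts\<close> is the application of the symbol \<open>(p, length ts)\<close>. Hence every element of the
  datatypes below is well-formed. Variables are \<open>Var 0, Var 1, \<dots>\<close>.
\<close>

datatype tm = Var nat | Fn pr "tm list"

datatype fm =
    Bot
  | Eq tm tm
  | Neg fm
  | And fm fm
  | Or fm fm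
  | Imp fm fm
  | All nat fm
  | Ex nat fm

abbreviation Iff :: "fm \<Rightarrow> fm \<Rightarrow> fm" where
  "Iff p q \<equiv> And (Imp p q) (Imp q p)"

fun fv_tm :: "tm \<Rightarrow> nat set" where
  "fv_tm (Var x) = {x}"
| "fv_tm (Fn p ts) = (\<Union>t\<in>set ts. fv_tm t)"

fun fv :: "fm \<Rightarrow> nat set" where
  "fv Bot = {}"
| "fv (Eq s t) = fv_tm s \<union> fv_tm t"
| "fv (Neg p) = fv p"
| "fv (And p q) = fv p \<union> fv q"
| "fv (Or p q) = fv p \<union> fv q"
| "fv (Imp p q) = fv p \<union> fv q"
| "fv (All x p) = fv p - {x}"
| "fv (Ex x p) = fv p - {x}"

definition sentence :: "fm \<Rightarrow> bool" where
  "sentence p \<longleftrightarrow> fv p = {}"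

abbreviation (input) v :: nat where "v \<equiv> 0"

definition v_formula :: "fm \<Rightarrow> bool" where
  "v_formula p \<longleftrightarrow> fv p \<subseteq> {v}"

text \<open>
  \<open>subst p t\<close> is \<open>p(t)\<close>: the free occurrences of \<open>v\<close> are replaced by \<open>t\<close>. Bound variables need no
  renaming because only terms \<open>t\<close> without variables other than \<open>v\<close> are ever substituted, and a
  free occurrence of \<open>v\<close> is not in the scope of a quantifier binding \<open>v\<close>.
\<close>

fun subst_tm :: "tm \<Rightarrow> tm \<Rightarrow> tm" where
  "subst_tm (Var x) t = (if x = v then t else Var x)"
| "subst_tm (Fn p ts) t = Fn p (map (\<lambda>s. subst_tm s t) ts)"

fun subst :: "fm \<Rightarrow> tm \<Rightarrow> fm" where
  "subst Bot t = Bot"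
| "subst (Eq r s) t = Eq (subst_tm r t) (subst_tm s t)"
| "subst (Neg p) t = Neg (subst p t)"
| "subst (And p q) t = And (subst p t) (subst q t)"
| "subst (Or p q) t = Or (subst p t) (subst q t)"
| "subst (Imp p q) t = Imp (subst p t) (subst q t)"
| "subst (All x p) t = (if x = v then All x p else All x (subst p t))"
| "subst (Ex x p) t = (if x = v then Ex x p else Ex x (subst p t))"

definition Zero :: tm where
  "Zero = Fn PZero []"

fun num :: "nat \<Rightarrow> tm" where
  "num 0 = Zero"
| "num (Suc n) = Fn PSucc [num n]"

fun tval :: "(nat \<Rightarrow> nat) \<Rightarrow> tm \<Rightarrow> nat" where
  "tval e (Var x) = e x"
| "tval e (Fn p ts) = pev p (map (tval e) ts)"

fun sat :: "(nat \<Rightarrow> nat) \<Rightarrow> fm \<Rightarrow> bool" where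
  "sat e Bot \<longleftrightarrow> False"
| "sat e (Eq s t) \<longleftrightarrow> tval e s = tval e t"
| "sat e (Neg p) \<longleftrightarrow> \<not> sat e p"
| "sat e (And p q) \<longleftrightarrow> sat e p \<and> sat e q"
| "sat e (Or p q) \<longleftrightarrow> sat e p \<or> sat e q"
| "sat e (Imp p q) \<longleftrightarrow> (sat e p \<longrightarrow> sat e q)"
| "sat e (All x p) \<longleftrightarrow> (\<forall>n. sat (e(x := n)) p)"
| "sat e (Ex x p) \<longleftrightarrow> (\<exists>n. sat (e(x := n)) p)"

definition true_N :: "fm \<Rightarrow> bool" ("\<nat> \<Turnstile> _" [51] 50) where
  "\<nat> \<Turnstile> p \<longleftrightarrow> (\<forall>e. sat e p)"

lemma tval_num [simp]: "tval e (num n) = n"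
  by (induction n) (auto simp: Zero_def arg_def)


section \<open>Goedel numbering\<close>

fun gn_pr :: "pr \<Rightarrow> nat" where
  "gn_pr PZero = 0"
| "gn_pr PSucc = 1"
| "gn_pr (PProj i) = 3 * i + 2"
| "gn_pr (PComp f gs) = 3 * prod_encode (gn_pr f, list_encode (map gn_pr gs)) + 3"
| "gn_pr (PRec f g) = 3 * prod_encode (gn_pr f, gn_pr g) + 4"

fun gn_tm :: "tm \<Rightarrow> nat" where
  "gn_tm (Var x) = 2 * x"
| "gn_tm (Fn p ts) = 2 * prod_encode (gn_pr p, list_encode (map gn_tm ts)) + 1"

fun gn :: "fm \<Rightarrow> nat" ("\<ulcorner>_\<urcorner>") where
  "\<ulcorner>Bot\<urcorner> = 0"
| "\<ulcorner>Eq s t\<urcorner> = Suc (7 * prod_encode (gn_tm s, gn_tm t))"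
| "\<ulcorner>Neg p\<urcorner> = Suc (7 * \<ulcorner>p\<urcorner> + 1)"
| "\<ulcorner>And p q\<urcorner> = Suc (7 * prod_encode (\<ulcorner>p\<urcorner>, \<ulcorner>q\<urcorner>) + 2)"
| "\<ulcorner>Or p q\<urcorner> = Suc (7 * prod_encode (\<ulcorner>p\<urcorner>, \<ulcorner>q\<urcorner>) + 3)"
| "\<ulcorner>Imp p q\<urcorner> = Suc (7 * prod_encode (\<ulcorner>p\<urcorner>, \<ulcorner>q\<urcorner>) + 4)"
| "\<ulcorner>All x p\<urcorner> = Suc (7 * prod_encode (x, \<ulcorner>p\<urcorner>) + 5)"
| "\<ulcorner>Ex x p\<urcorner> = Suc (7 * prod_encode (x, \<ulcorner>p\<urcorner>) + 6)"

lemma mod_div_eqD: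
  fixes a b m r s :: nat
  assumes "m * a + r = m * b + s" "r < m" "s < m"
  shows "a = b \<and> r = s"
proof -
  have "(m * a + r) div m = (m * b + s) div m" "(m * a + r) mod m = (m * b + s) mod m"
    using assms(1) by simp_all
  then show ?thesis using assms(2,3) by simp
qed

lemma gn_pr_inj: "gn_pr p = gn_pr q \<Longrightarrow> p = q"
proof (induction p arbitrary: q)
  case PZero then show ?case by (cases q) auto
next
  case PSucc then show ?case by (cases q; simp; presburger)
next
  case (PProj i) then show ?case by (cases q; simp; presburger)
next
  case (PComp f gs)
  show ?case
  proof (cases q)
    case (PComp f' gs')
    then have *: "gn_pr f = gn_pr f'" "map gn_pr gs = map gn_pr gs'"
      using PComp.prems by (auto simp: list_encode_eq)
    have "gs = gs'"
      using *(2) PComp.IH(2)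
    proof (induction gs arbitrary: gs')
      case Nil then show ?case by simp
    next
      case (Cons g gs)
      then obtain h hs where "gs' = h # hs" by (cases gs') auto
      with Cons show ?case by auto
    qed
    with * PComp PComp.IH(1) show ?thesis by blast
  qed (use PComp.prems in \<open>simp; presburger\<close>)+
next
  case (PRec f g)
  show ?case
  proof (cases q)
    case (PRec f' g')
    then show ?thesis using PRec.prems PRec.IH by simp
  qed (use PRec.prems in \<open>simp; presburger\<close>)+
qed

lemma gn_tm_inj: "gn_tm s = gn_tm t \<Longrightarrow> s = t"
proof (induction s arbitrary: t)
  case (Var x) then show ?case by (cases t; simp; presburger)
next
  case (Fn p ts)
  show ?case
  proof (cases t)
    case (Var x) then show ?thesis using Fn.prems by (simp; presburger)
  next
    case (Fn p' ts')
    then have *: "p = p'" "map gn_tm ts = map gn_tm ts'"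
      using Fn.prems by (auto simp: list_encode_eq intro: gn_pr_inj)
    have "ts = ts'"
      using *(2) Fn.IH
    proof (induction ts arbitrary: ts')
      case Nil then show ?case by simp
    next
      case (Cons g gs)
      then obtain h hs where "ts' = h # hs" by (cases ts') auto
      with Cons show ?case by auto
    qed
    with * Fn show ?thesis by blast
  qed
qed

lemma gn_inj: "\<ulcorner>p\<urcorner> = \<ulcorner>q\<urcorner> \<Longrightarrow> p = q"
proof (induction p arbitrary: q)
  case Bot then show ?case by (cases q) auto
next
  case (Eq s t) then show ?case
    by (cases q; simp; (presburger | blast intro: gn_tm_inj))
next
  case (Neg p) then show ?case by (cases q; simp; presburger)
next
  case (And p p') then show ?case
    by (cases q; simp; (presburger | (drule mod_div_eqD; simp)))
next
  case (Or p p') then show ?case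
    by (cases q; simp; (presburger | (drule mod_div_eqD; simp)))
next
  case (Imp p p') then show ?case
    by (cases q; simp; (presburger | (drule mod_div_eqD; simp)))
next
  case (All x p) then show ?case
    by (cases q; simp; (presburger | (drule mod_div_eqD; simp)))
next
  case (Ex x p) then show ?case
    by (cases q; simp; (presburger | (drule mod_div_eqD; simp)))
qed

lemma list_encode_surj_on:
  assumes "\<And>x. x \<in> set (list_decode n) \<Longrightarrow> x \<in> range f"
  shows "\<exists>ys. n = list_encode (map f ys)"
proof -
  have "\<exists>ys. xs = map f ys" if "set xs \<subseteq> range f" for xs
    using that by (simp add: ex_map_conv subset_iff image_iff)
  then obtain ys where "list_decode n = map f ys" using assms by blast
  then show ?thesis by (metis list_decode_inverse)
qed

lemma list_decode_le: "x \<in> set (list_decode n) \<Longrightarrow> x < n"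
proof (induction n rule: less_induct)
  case (less n)
  show ?case
  proof (cases n)
    case 0 then show ?thesis using less.prems by simp
  next
    case (Suc m)
    obtain a b where ab: "prod_decode m = (a, b)" by fastforce
    then have m: "m = prod_encode (a, b)" by (metis prod_decode_inverse)
    have "a \<le> m" "b \<le> m" unfolding m by (rule le_prod_encode_1, rule le_prod_encode_2)
    moreover have "x = a \<or> x \<in> set (list_decode b)" using less.prems Suc ab by simp
    ultimately show ?thesis using less.IH[of b] Suc by auto
  qed
qed

lemma prod_encode_cases:
  obtains a b where "n = prod_encode (a, b)" "a \<le> n" "b \<le> n"
  by (metis le_prod_encode_1 le_prod_encode_2 prod_decode_inverse surj_pair)

lemma gn_pr_surj: "n \<in> range gn_pr"
proof (induction n rule: less_induct)
  case (less n)
  consider "n = 0" | "n = 1" | m where "n = 3 * m + 2" | m where "n = 3 * m + 3"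
    | m where "n = 3 * m + 4"
    by atomize_elim presburger
  then show ?case
  proof cases
    case 1 then show ?thesis by (metis gn_pr.simps(1) rangeI)
  next
    case 2 then show ?thesis by (metis gn_pr.simps(2) rangeI)
  next
    case (3 m) then show ?thesis by (metis gn_pr.simps(3) rangeI)
  next
    case (4 m)
    obtain a b where ab: "m = prod_encode (a, b)" "a \<le> m" "b \<le> m" by (rule prod_encode_cases)
    obtain f where f: "a = gn_pr f" using less.IH[of a] ab 4 by auto
    obtain gs where gs: "b = list_encode (map gn_pr gs)"
    proof -
      have "x \<in> range gn_pr" if "x \<in> set (list_decode b)" for x
        using list_decode_le[OF that] ab 4 by (intro less.IH) linarith
      then have "\<exists>gs. b = list_encode (map gn_pr gs)" by (rule list_encode_surj_on)
      then show ?thesis using that by blast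
    qed
    show ?thesis using ab(1) f gs 4 by (intro range_eqI[of _ _ "PComp f gs"]) simp
  next
    case (5 m)
    obtain a b where ab: "m = prod_encode (a, b)" "a \<le> m" "b \<le> m" by (rule prod_encode_cases)
    obtain f g where "a = gn_pr f" "b = gn_pr g"
      using less.IH[of a] less.IH[of b] ab 5 by auto
    then show ?thesis using ab(1) 5 by (intro range_eqI[of _ _ "PRec f g"]) simp
  qed
qed

lemma gn_tm_surj: "n \<in> range gn_tm"
proof (induction n rule: less_induct)
  case (less n)
  consider m where "n = 2 * m" | m where "n = 2 * m + 1"
    by atomize_elim presburger
  then show ?case
  proof cases
    case (1 m) then show ?thesis by (metis gn_tm.simps(1) rangeI)
  next
    case (2 m)
    obtain a b where ab: "m = prod_encode (a, b)" "a \<le> m" "b \<le> m" by (rule prod_encode_cases)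
    obtain f where f: "a = gn_pr f" using gn_pr_surj by blast
    obtain gs where gs: "b = list_encode (map gn_tm gs)"
    proof -
      have "x \<in> range gn_tm" if "x \<in> set (list_decode b)" for x
        using list_decode_le[OF that] ab 2 by (intro less.IH) linarith
      then have "\<exists>gs. b = list_encode (map gn_tm gs)" by (rule list_encode_surj_on)
      then show ?thesis using that by blast
    qed
    show ?thesis using ab(1) f gs 2 by (intro range_eqI[of _ _ "Fn f gs"]) simp
  qed
qed

lemma gn_surj: "n \<in> range gn"
proof (induction n rule: less_induct)
  case (less n)
  show ?case
  proof (cases n)
    case 0 then show ?thesis by (metis gn.simps(1) rangeI)
  next
    case (Suc k)
    obtain m r where mr: "k = 7 * m + r" "r < 7"
      using that[of "k div 7" "k mod 7"] by simp
    obtain a b where ab: "m = prod_encode (a, b)" "a \<le> m" "b \<le> m" by (rule prod_encode_cases)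
    have lt: "m < n" "a < n" "b < n" using ab mr Suc by auto
    obtain p q u where pq: "a = \<ulcorner>p\<urcorner>" "b = \<ulcorner>q\<urcorner>" "m = \<ulcorner>u\<urcorner>" using less.IH lt by blast
    obtain s t where st: "a = gn_tm s" "b = gn_tm t" using gn_tm_surj by blast
    consider "r = 0" | "r = 1" | "r = 2" | "r = 3" | "r = 4" | "r = 5" | "r = 6"
      using mr(2) by linarith
    then show ?thesis
    proof cases
      case 1 then have "n = \<ulcorner>Eq s t\<urcorner>" using Suc mr ab(1) st by simp
      then show ?thesis by blast
    next
      case 2 then have "n = \<ulcorner>Neg u\<urcorner>" using Suc mr pq by simp
      then show ?thesis by blast
    next
      case 3 then have "n = \<ulcorner>And p q\<urcorner>" using Suc mr ab(1) pq by simp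
      then show ?thesis by blast
    next
      case 4 then have "n = \<ulcorner>Or p q\<urcorner>" using Suc mr ab(1) pq by simp
      then show ?thesis by blast
    next
      case 5 then have "n = \<ulcorner>Imp p q\<urcorner>" using Suc mr ab(1) pq by simp
      then show ?thesis by blast
    next
      case 6 then have "n = \<ulcorner>All a q\<urcorner>" using Suc mr ab(1) pq by simp
      then show ?thesis by blast
    next
      case 7 then have "n = \<ulcorner>Ex a q\<urcorner>" using Suc mr ab(1) pq by simp
      then show ?thesis by blast
    qed
  qed
qed

lemma bij_gn: "bij gn"
  using gn_inj gn_surj by (auto simp: bij_def inj_def)

text \<open>The numbering is a bijection, so \<open>\<phi> i\<close> is the formula with number \<open>i\<close>.\<close>

definition \<phi> :: "nat \<Rightarrow> fm" where
  "\<phi> = inv gn"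

lemma gn_\<phi> [simp]: "\<ulcorner>\<phi> i\<urcorner> = i"
  by (simp add: \<phi>_def bij_gn bij_is_surj surj_f_inv_f)

lemma \<phi>_gn [simp]: "\<phi> \<ulcorner>p\<urcorner> = p"
  by (simp add: \<phi>_def bij_gn bij_is_inj)

definition \<Gamma> :: "nat set" where
  "\<Gamma> = {\<ulcorner>p\<urcorner> | p. v_formula p}"

lemma \<Gamma>_iff: "i \<in> \<Gamma> \<longleftrightarrow> v_formula (\<phi> i)"
  unfolding \<Gamma>_def by (auto intro: exI[of _ "\<phi> i"])

definition d :: "nat \<Rightarrow> nat" where
  "d i = (if i \<in> \<Gamma> then \<ulcorner>subst (\<phi> i) (num i)\<urcorner> else 0)"


section \<open>The function \<open>d\<close> is primitive recursive\<close>

definition PR :: "nat \<Rightarrow> (nat list \<Rightarrow> nat) \<Rightarrow> bool" where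
  "PR n F \<longleftrightarrow> (\<exists>p. \<forall>xs. length xs = n \<longrightarrow> pev p xs = F xs)"

named_theorems pr_intro

lemma PR_cong: "PR n F \<Longrightarrow> (\<And>xs. length xs = n \<Longrightarrow> F xs = G xs) \<Longrightarrow> PR n G"
  unfolding PR_def by auto

lemma PR_proj [pr_intro]: "i < n \<Longrightarrow> PR n (\<lambda>xs. xs ! i)"
  unfolding PR_def by (rule exI[of _ "PProj i"]) (simp add: arg_def)

lemma PR_comp:
  assumes "PR m F" "\<forall>G\<in>set Gs. PR n G" "length Gs = m"
  shows "PR n (\<lambda>xs. F (map (\<lambda>G. G xs) Gs))"
proof -
  obtain p where p: "\<And>xs. length xs = m \<Longrightarrow> pev p xs = F xs"
    using assms(1) unfolding PR_def by auto
  obtain q where q: "\<And>G xs. G \<in> set Gs \<Longrightarrow> length xs = n \<Longrightarrow> pev (q G) xs = G xs"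
    using assms(2) unfolding PR_def by metis
  have "pev (PComp p (map q Gs)) xs = F (map (\<lambda>G. G xs) Gs)" if "length xs = n" for xs
  proof -
    have "map (\<lambda>g. pev g xs) (map q Gs) = map (\<lambda>G. G xs) Gs"
      using q that by simp
    then show ?thesis using p assms(3) by (simp only: pev.simps length_map)
  qed
  then show ?thesis unfolding PR_def by blast
qed

lemma PR_comp1: "PR 1 (\<lambda>xs. f (xs ! 0)) \<Longrightarrow> PR n F \<Longrightarrow> PR n (\<lambda>xs. f (F xs))"
  using PR_comp[of 1 "\<lambda>xs. f (xs ! 0)" "[F]" n] by simp

lemma PR_comp2:
  "PR 2 (\<lambda>xs. f (xs ! 0) (xs ! 1)) \<Longrightarrow> PR n F \<Longrightarrow> PR n G \<Longrightarrow> PR n (\<lambda>xs. f (F xs) (G xs))"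
  using PR_comp[of 2 "\<lambda>xs. f (xs ! 0) (xs ! 1)" "[F, G]" n] by simp

lemma PR_comp3:
  "PR 3 (\<lambda>xs. f (xs ! 0) (xs ! 1) (xs ! 2)) \<Longrightarrow> PR n F \<Longrightarrow> PR n G \<Longrightarrow> PR n H \<Longrightarrow>
    PR n (\<lambda>xs. f (F xs) (G xs) (H xs))"
  using PR_comp[of 3 "\<lambda>xs. f (xs ! 0) (xs ! 1) (xs ! 2)" "[F, G, H]" n] by simp

lemma PR_Suc [pr_intro]: "PR n F \<Longrightarrow> PR n (\<lambda>xs. Suc (F xs))"
  by (rule PR_comp1) (auto simp: PR_def arg_def intro!: exI[of _ PSucc])

lemma PR_0: "PR n (\<lambda>xs. 0)"
  unfolding PR_def by (rule exI[of _ PZero]) simp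

lemma PR_const [pr_intro]: "PR n (\<lambda>xs. c)"
  by (induction c) (auto intro: PR_0 PR_Suc)

lemma PR_rec:
  assumes "PR 1 (\<lambda>xs. g (xs ! 0))" "PR 3 (\<lambda>xs. h (xs ! 0) (xs ! 1) (xs ! 2))"
    and "\<And>y. f 0 y = g y" "\<And>k y. f (Suc k) y = h k (f k y) y"
  shows "PR 2 (\<lambda>xs. f (xs ! 0) (xs ! 1))"
proof -
  obtain p where p: "\<And>xs. length xs = 1 \<Longrightarrow> pev p xs = g (xs ! 0)"
    using assms(1) unfolding PR_def by auto
  obtain q where q: "\<And>xs. length xs = 3 \<Longrightarrow> pev q xs = h (xs ! 0) (xs ! 1) (xs ! 2)"
    using assms(2) unfolding PR_def by auto
  have "pev (PRec p q) xs = f (xs ! 0) (xs ! 1)" if len: "length xs = 2" for xs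
  proof -
    obtain x y where xs: "xs = [x, y]" using len
      by (metis (no_types, opaque_lifting) Suc_length_conv length_0_conv numeral_2_eq_2)
    have "rec_nat (pev p [y]) (\<lambda>k r. pev q [k, r, y]) x = f x y"
      by (induction x) (auto simp: p q assms(3,4))
    then show ?thesis by (simp add: xs arg_def)
  qed
  then show ?thesis unfolding PR_def by blast
qed

lemma PR_rec1:
  assumes "PR 2 (\<lambda>xs. h (xs ! 0) (xs ! 1))"
    and "\<And>k. f (Suc k) = h k (f k)"
  shows "PR 1 (\<lambda>xs. f (xs ! 0))"
proof -
  have "PR 2 (\<lambda>xs. (\<lambda>x y. f x) (xs ! 0) (xs ! 1))"
  proof (rule PR_rec[where f = "\<lambda>x y. f x" and g = "\<lambda>y. f 0" and h = "\<lambda>k r y. h k r"])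
    show "PR 3 (\<lambda>xs. h (xs ! 0) (xs ! 1))"
      by (rule PR_comp2[OF assms(1)]) (rule PR_proj; simp)+
  qed (simp_all add: PR_const assms(2))
  then have "PR 1 (\<lambda>xs. (\<lambda>x y. f x) (xs ! 0) (xs ! 0))"
    by (rule PR_comp2) (rule PR_proj; simp)+
  then show ?thesis by simp
qed

lemma PR_pred: "PR n F \<Longrightarrow> PR n (\<lambda>xs. F xs - 1)"
proof (rule PR_comp1[where f = "\<lambda>x. x - 1"])
  show "PR 1 (\<lambda>xs. xs ! 0 - 1)"
    by (rule PR_rec1[where f = "\<lambda>x. x - 1" and h = "\<lambda>k r. k"]) (auto intro: pr_intro)
qed

lemma PR_add [pr_intro]: "PR n F \<Longrightarrow> PR n G \<Longrightarrow> PR n (\<lambda>xs. F xs + G xs)"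
proof (rule PR_comp2[where f = "(+)"])
  show "PR 2 (\<lambda>xs. xs ! 0 + xs ! 1)"
    by (rule PR_rec[where f = "\<lambda>x y. x + y" and g = "\<lambda>y. y" and h = "\<lambda>k r y. Suc r"]) ((intro pr_intro; simp)+, simp_all)
qed

lemma PR_mult [pr_intro]: "PR n F \<Longrightarrow> PR n G \<Longrightarrow> PR n (\<lambda>xs. F xs * G xs)"
proof (rule PR_comp2[where f = "(*)"])
  show "PR 2 (\<lambda>xs. xs ! 0 * xs ! 1)"
    by (rule PR_rec[where f = "\<lambda>x y. x * y" and g = "\<lambda>y. 0" and h = "\<lambda>k r y. y + r"]) ((intro pr_intro; simp)+, simp_all)
qed

lemma PR_diff [pr_intro]: "PR n F \<Longrightarrow> PR n G \<Longrightarrow> PR n (\<lambda>xs. F xs - G xs)"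
proof (rule PR_comp2[where f = "\<lambda>x y. y - x" and F = G and G = F])
  show "PR 2 (\<lambda>xs. xs ! 1 - xs ! 0)"
    by (rule PR_rec[where f = "\<lambda>x y. y - x" and g = "\<lambda>y. y" and h = "\<lambda>k r y. r - 1"])
      ((intro pr_intro PR_pred; simp), (intro pr_intro PR_pred; simp), simp_all)
qed

lemma PR_if0:
  assumes "PR n C" "PR n A" "PR n B"
  shows "PR n (\<lambda>xs. if C xs = 0 then A xs else B xs)"
proof -
  have "PR n (\<lambda>xs. (1 - C xs) * A xs + (1 - (1 - C xs)) * B xs)"
    by (intro pr_intro assms)
  then show ?thesis by (rule PR_cong) auto
qed

lemma PR_if_le [pr_intro]:
  assumes "PR n C" "PR n D" "PR n A" "PR n B"
  shows "PR n (\<lambda>xs. if C xs \<le> D xs then A xs else B xs)"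
  using PR_if0[OF PR_diff[OF assms(1,2)] assms(3,4)] by (simp only: diff_is_0_eq)

lemma PR_if_eq [pr_intro]:
  assumes "PR n C" "PR n D" "PR n A" "PR n B"
  shows "PR n (\<lambda>xs. if C xs = D xs then A xs else B xs)"
proof -
  have "PR n (\<lambda>xs. if C xs \<le> D xs then if D xs \<le> C xs then A xs else B xs else B xs)"
    using assms by (intro pr_intro)
  then show ?thesis by (rule PR_cong) auto
qed

lemma PR_mod [pr_intro]: "PR n F \<Longrightarrow> PR n G \<Longrightarrow> PR n (\<lambda>xs. F xs mod G xs)"
proof (rule PR_comp2[where f = "(mod)"])
  show "PR 2 (\<lambda>xs. xs ! 0 mod xs ! 1)"
    by (rule PR_rec[where f = "\<lambda>x y. x mod y" and g = "\<lambda>y. 0" and h = "\<lambda>k r y. if Suc r = y then 0 else Suc r"])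
      (auto intro!: pr_intro simp: mod_Suc)
qed

lemma PR_div [pr_intro]: "PR n F \<Longrightarrow> PR n G \<Longrightarrow> PR n (\<lambda>xs. F xs div G xs)"
proof (rule PR_comp2[where f = "(div)"])
  show "PR 2 (\<lambda>xs. xs ! 0 div xs ! 1)"
    by (rule PR_rec[where f = "\<lambda>x y. x div y" and g = "\<lambda>y. 0" and h = "\<lambda>k r y. if Suc k mod y = 0 then Suc r else r"])
      (auto intro!: pr_intro simp: div_Suc)
qed

lemma PR_triangle: "PR n F \<Longrightarrow> PR n (\<lambda>xs. triangle (F xs))"
  unfolding triangle_def by (intro pr_intro)

lemma PR_prod_encode [pr_intro]:
  "PR n F \<Longrightarrow> PR n G \<Longrightarrow> PR n (\<lambda>xs. prod_encode (F xs, G xs))"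
  unfolding prod_encode_def prod.case by (intro pr_intro PR_triangle)

definition diag :: "nat \<Rightarrow> nat" where
  "diag x = fst (prod_decode x) + snd (prod_decode x)"

lemma diag_bounds: "triangle (diag x) \<le> x" "x < triangle (Suc (diag x))"
proof -
  obtain a b where ab: "prod_decode x = (a, b)" by fastforce
  have x: "x = triangle (a + b) + a"
    using prod_decode_inverse[of x] by (simp add: ab prod_encode_def)
  have "diag x = a + b" by (simp add: diag_def ab)
  then show "triangle (diag x) \<le> x" "x < triangle (Suc (diag x))"
    by (simp_all add: x)
qed

lemma triangle_mono: "m \<le> n \<Longrightarrow> triangle m \<le> triangle n"
  by (induction n) (auto simp: le_Suc_eq)

lemma diag_unique: "triangle s \<le> x \<Longrightarrow> x < triangle (Suc s) \<Longrightarrow> diag x = s"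
  using diag_bounds[of x] triangle_mono[of "Suc s" "diag x"] triangle_mono[of "Suc (diag x)" s]
  by (metis leD le_less_trans less_le_trans not_less_eq_eq order_antisym_conv)

lemma diag_Suc: "diag (Suc x) = (if triangle (Suc (diag x)) \<le> Suc x then Suc (diag x) else diag x)"
  using diag_bounds[of x] by (auto intro!: diag_unique)

lemma PR_diag: "PR n F \<Longrightarrow> PR n (\<lambda>xs. diag (F xs))"
proof (rule PR_comp1[where f = diag])
  show "PR 1 (\<lambda>xs. diag (xs ! 0))"
  proof (rule PR_rec1[where f = "\<lambda>x. diag (x)" and h = "\<lambda>k r. if triangle (Suc r) \<le> Suc k then Suc r else r"])
    show "PR 2 (\<lambda>xs. if triangle (Suc (xs ! 1)) \<le> Suc (xs ! 0) then Suc (xs ! 1) else xs ! 1)"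
      by (intro pr_intro PR_triangle; simp)
  qed (rule diag_Suc)
qed

definition pfst :: "nat \<Rightarrow> nat" where "pfst x = fst (prod_decode x)"
definition psnd :: "nat \<Rightarrow> nat" where "psnd x = snd (prod_decode x)"

lemma pfst_encode [simp]: "pfst (prod_encode (a, b)) = a" by (simp add: pfst_def)
lemma psnd_encode [simp]: "psnd (prod_encode (a, b)) = b" by (simp add: psnd_def)

lemma pfst_diag: "pfst x = x - triangle (diag x)" "psnd x = diag x - pfst x"
  by (metis (no_types, lifting) add_diff_cancel_left' diag_def pfst_def prod.collapse
      prod_decode_inverse prod_encode_def prod.case, simp add: diag_def pfst_def psnd_def)

lemma PR_pfst [pr_intro]: "PR n F \<Longrightarrow> PR n (\<lambda>xs. pfst (F xs))"
  unfolding pfst_diag by (intro pr_intro PR_diag PR_triangle)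

lemma PR_psnd [pr_intro]: "PR n F \<Longrightarrow> PR n (\<lambda>xs. psnd (F xs))"
  unfolding pfst_diag(2) by (intro pr_intro PR_diag)

lemma pfst_le: "pfst x \<le> x" and psnd_le: "psnd x \<le> x"
  by (metis le_prod_encode_1 le_prod_encode_2 pfst_def psnd_def prod.collapse prod_decode_inverse)+

text \<open>Course-of-values recursion with a parameter \<open>y\<close> and three recursive calls.\<close>

fun hist :: "(nat \<Rightarrow> nat) \<Rightarrow> nat \<Rightarrow> nat" where
  "hist f 0 = prod_encode (f 0, 0)"
| "hist f (Suc n) = prod_encode (f (Suc n), hist f n)"

fun itsnd :: "nat \<Rightarrow> nat \<Rightarrow> nat" where
  "itsnd 0 y = y"
| "itsnd (Suc n) y = psnd (itsnd n y)"

lemma PR_itsnd: "PR n F \<Longrightarrow> PR n G \<Longrightarrow> PR n (\<lambda>xs. itsnd (F xs) (G xs))"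
proof (rule PR_comp2[where f = itsnd])
  show "PR 2 (\<lambda>xs. itsnd (xs ! 0) (xs ! 1))"
    by (rule PR_rec[where f = "\<lambda>x y. itsnd (x) (y)" and g = "\<lambda>y. y" and h = "\<lambda>k r y. psnd r"]) ((intro pr_intro; simp)+, simp_all)
qed

lemma itsnd_hist: "k \<le> n \<Longrightarrow> itsnd k (hist f n) = hist f (n - k)"
proof (induction k)
  case (Suc k)
  then have "n - k = Suc (n - Suc k)" by simp
  with Suc show ?case by simp
qed simp

lemma pfst_hist [simp]: "pfst (hist f n) = f n"
  by (cases n) auto

lemma hist_lookup: "k \<le> n \<Longrightarrow> pfst (itsnd (n - k) (hist f n)) = f k"
  by (simp add: itsnd_hist)

lemma PR_course:
  assumes a: "PR 1 (\<lambda>xs. a (xs ! 0))" and b: "PR 1 (\<lambda>xs. b (xs ! 0))"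
    and c: "PR 1 (\<lambda>xs. c (xs ! 0))"
    and le: "\<And>x. a x \<le> x" "\<And>x. b x \<le> x" "\<And>x. c x \<le> x"
    and g: "PR 1 (\<lambda>xs. g (xs ! 0))"
    and G: "PR 5 (\<lambda>xs. G (xs ! 0) (xs ! 1) (xs ! 2) (xs ! 3) (xs ! 4))"
  shows "\<exists>f. PR 2 (\<lambda>xs. f (xs ! 0) (xs ! 1)) \<and> (\<forall>y. f 0 y = g y) \<and>
    (\<forall>x y. f (Suc x) y = G x y (f (a x) y) (f (b x) y) (f (c x) y))"
proof -
  define look where "look x h k = pfst (itsnd (x - k) h)" for x h k
  define st where "st x h y = G x y (look x h (a x)) (look x h (b x)) (look x h (c x))" for x h y
  define H where "H x y = rec_nat (prod_encode (g y, 0)) (\<lambda>k r. prod_encode (st k r y, r)) x" for x y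
  define f where "f x y = pfst (H x y)" for x y
  have look: "PR n (\<lambda>xs. look (A xs) (B xs) (C xs))" if "PR n A" "PR n B" "PR n C" for n A B C
    unfolding look_def using that by (intro pr_intro PR_itsnd)
  have st: "PR 3 (\<lambda>xs. st (xs ! 0) (xs ! 1) (xs ! 2))"
  proof -
    let ?X = "\<lambda>xs :: nat list. xs ! 0" and ?h = "\<lambda>xs :: nat list. xs ! 1"
      and ?Y = "\<lambda>xs :: nat list. xs ! 2"
    have X: "PR 3 ?X" "PR 3 ?h" "PR 3 ?Y" by (rule PR_proj; simp)+
    have "PR 3 (\<lambda>xs. (\<lambda>xs. G (xs ! 0) (xs ! 1) (xs ! 2) (xs ! 3) (xs ! 4)) (map (\<lambda>G. G xs)
      [?X, ?Y, \<lambda>xs. look (?X xs) (?h xs) (a (?X xs)), \<lambda>xs. look (?X xs) (?h xs) (b (?X xs)),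
        \<lambda>xs. look (?X xs) (?h xs) (c (?X xs))]))"
      by (rule PR_comp[OF G]) (auto intro!: X look PR_comp1[OF a] PR_comp1[OF b] PR_comp1[OF c]
          simp del: One_nat_def)
    then show ?thesis by (simp add: st_def numeral_eq_Suc)
  qed
  have "PR 2 (\<lambda>xs. H (xs ! 0) (xs ! 1))"
  proof (rule PR_rec[where f = "\<lambda>x y. H (x) (y)" and g = "\<lambda>y. prod_encode (g y, 0)" and h = "\<lambda>k r y. prod_encode (st k r y, r)"])
    show "PR 1 (\<lambda>xs. prod_encode (g (xs ! 0), 0))" by (intro pr_intro g)
    show "PR 3 (\<lambda>xs. prod_encode (st (xs ! 0) (xs ! 1) (xs ! 2), xs ! 1))"
      by (intro pr_intro st) simp
  qed (simp_all add: H_def)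
  then have PRf: "PR 2 (\<lambda>xs. f (xs ! 0) (xs ! 1))"
    unfolding f_def by (rule PR_pfst)
  have H: "H x y = hist (\<lambda>z. f z y) x" for x y
    by (induction x) (auto simp: f_def H_def)
  have "f 0 y = g y" for y by (simp add: f_def H_def)
  moreover have "f (Suc x) y = G x y (f (a x) y) (f (b x) y) (f (c x) y)" for x y
  proof -
    have "f (Suc x) y = st x (H x y) y" by (simp add: f_def H_def)
    also have "\<dots> = G x y (f (a x) y) (f (b x) y) (f (c x) y)"
      unfolding st_def look_def H using le by (simp add: hist_lookup)
    finally show ?thesis .
  qed
  ultimately show ?thesis using PRf by blast
qed

text \<open>
  Substitution and free variables on codes. Terms and lists of terms are treated simultaneously,
  by a function whose value pairs the value for the term with the value for the list coded by its
  argument.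
\<close>

lemma PR_gn_num: "PR n F \<Longrightarrow> PR n (\<lambda>xs. gn_tm (num (F xs)))"
proof (rule PR_comp1[where f = "\<lambda>x. gn_tm (num x)"])
  show "PR 1 (\<lambda>xs. gn_tm (num (xs ! 0)))"
    by (rule PR_rec1[where f = "\<lambda>x. gn_tm (num (x))" and h = "\<lambda>k r. 2 * prod_encode (1, Suc (prod_encode (r, 0))) + 1"])
      ((intro pr_intro; simp), (simp add: Zero_def))
qed

lemma PR_subst_tm:
  "\<exists>f. PR 2 (\<lambda>xs. f (xs ! 0) (xs ! 1)) \<and> (\<forall>t i. f (gn_tm t) i = gn_tm (subst_tm t (num i)))"
proof -
  define G where "G x y r1 r2 r3 = prod_encode
    (if Suc x mod 2 = 0 then Suc x else 2 * prod_encode (pfst (x div 2), psnd r3) + 1,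
     Suc (prod_encode (pfst r1, psnd r2)))" for x y r1 r2 r3 :: nat
  have "\<exists>f. PR 2 (\<lambda>xs. f (xs ! 0) (xs ! 1)) \<and> (\<forall>y. f 0 y = prod_encode (gn_tm (num y), 0)) \<and>
    (\<forall>x y. f (Suc x) y = G x y (f (pfst x) y) (f (psnd x) y) (f (psnd (x div 2)) y))"
  proof (rule PR_course[where a = pfst and b = psnd and c = "\<lambda>x. psnd (x div 2)" and G = G
        and g = "\<lambda>y. prod_encode (gn_tm (num y), 0)"])
    show "psnd (x div 2) \<le> x" for x
      using psnd_le[of "x div 2"] by linarith
    show "PR 5 (\<lambda>xs. G (xs ! 0) (xs ! 1) (xs ! 2) (xs ! 3) (xs ! 4))"
      unfolding G_def by (intro pr_intro; simp)
  qed (intro pr_intro PR_gn_num pfst_le psnd_le; simp)+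
  then obtain f where f: "PR 2 (\<lambda>xs. f (xs ! 0) (xs ! 1))"
    "\<And>y. f 0 y = prod_encode (gn_tm (num y), 0)"
    "\<And>x y. f (Suc x) y = G x y (f (pfst x) y) (f (psnd x) y) (f (psnd (x div 2)) y)" by blast
  have lst: "psnd (f (list_encode (map gn_tm ts)) i)
      = list_encode (map (\<lambda>t. gn_tm (subst_tm t (num i))) ts)"
    if "\<forall>t\<in>set ts. pfst (f (gn_tm t) i) = gn_tm (subst_tm t (num i))" for ts i
    using that by (induction ts) (auto simp: f(2,3) G_def)
  have "pfst (f (gn_tm t) i) = gn_tm (subst_tm t (num i))" for t i
  proof (induction t)
    case (Var x)
    show ?case
    proof (cases x)
      case 0 then show ?thesis by (simp add: f(2))
    next
      case (Suc n)
      then have "2 * x = Suc (Suc (2 * n))" by simp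
      then show ?thesis using Suc by (simp add: f(3) G_def)
    qed
  next
    case (Fn p ts)
    have "psnd (f (list_encode (map gn_tm ts)) i)
      = list_encode (map (\<lambda>t. gn_tm (subst_tm t (num i))) ts)"
      by (rule lst) (use Fn in blast)
    then show ?case by (simp add: f(3) G_def comp_def)
  qed
  moreover have "PR 2 (\<lambda>xs. pfst (f (xs ! 0) (xs ! 1)))" by (rule PR_pfst[OF f(1)])
  ultimately show ?thesis by (intro exI[of _ "\<lambda>x y. pfst (f x y)"]) simp
qed

lemma PR_fv_tm:
  "\<exists>f. PR 2 (\<lambda>xs. f (xs ! 0) (xs ! 1)) \<and> (\<forall>t y. f (gn_tm t) y = of_bool (y \<in> fv_tm t))"
proof -
  define G where "G x y r1 r2 r3 = prod_encode
    (if Suc x mod 2 = 0 then if Suc x = 2 * y then 1 else 0 else psnd r3,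
     if pfst r1 = 0 then psnd r2 else 1)" for x y r1 r2 r3 :: nat
  have "\<exists>f. PR 2 (\<lambda>xs. f (xs ! 0) (xs ! 1)) \<and>
    (\<forall>y. f 0 y = prod_encode (if y = 0 then 1 else 0, 0)) \<and>
    (\<forall>x y. f (Suc x) y = G x y (f (pfst x) y) (f (psnd x) y) (f (psnd (x div 2)) y))"
  proof (rule PR_course[where a = pfst and b = psnd and c = "\<lambda>x. psnd (x div 2)" and G = G
        and g = "\<lambda>y. prod_encode (if y = 0 then 1 else 0, 0)"])
    show "psnd (x div 2) \<le> x" for x
      using psnd_le[of "x div 2"] by linarith
    show "PR 5 (\<lambda>xs. G (xs ! 0) (xs ! 1) (xs ! 2) (xs ! 3) (xs ! 4))"
      unfolding G_def by (intro pr_intro; simp)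
    show "PR 1 (\<lambda>xs. prod_encode (if xs ! 0 = 0 then 1 else 0, 0))"
      by (intro pr_intro; simp)
  qed (intro pr_intro pfst_le psnd_le; simp)+
  then obtain f where f: "PR 2 (\<lambda>xs. f (xs ! 0) (xs ! 1))"
    "\<And>y. f 0 y = prod_encode (if y = 0 then 1 else 0, 0)"
    "\<And>x y. f (Suc x) y = G x y (f (pfst x) y) (f (psnd x) y) (f (psnd (x div 2)) y)" by blast
  have lst: "psnd (f (list_encode (map gn_tm ts)) y) = of_bool (\<exists>t\<in>set ts. y \<in> fv_tm t)"
    if "\<forall>t\<in>set ts. pfst (f (gn_tm t) y) = of_bool (y \<in> fv_tm t)" for ts y
    using that by (induction ts) (auto simp: f(2,3) G_def)
  have "pfst (f (gn_tm t) y) = of_bool (y \<in> fv_tm t)" for t y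
  proof (induction t)
    case (Var x)
    show ?case
    proof (cases x)
      case 0 then show ?thesis by (simp add: f(2))
    next
      case (Suc n)
      then have "2 * x = Suc (Suc (2 * n))" by simp
      then show ?thesis using Suc by (auto simp: f(3) G_def)
    qed
  next
    case (Fn p ts)
    have "psnd (f (list_encode (map gn_tm ts)) y) = of_bool (\<exists>t\<in>set ts. y \<in> fv_tm t)"
      by (rule lst) (use Fn in blast)
    then show ?case by (simp add: f(3) G_def)
  qed
  moreover have "PR 2 (\<lambda>xs. pfst (f (xs ! 0) (xs ! 1)))" by (rule PR_pfst[OF f(1)])
  ultimately show ?thesis by (intro exI[of _ "\<lambda>x y. pfst (f x y)"]) simp
qed

lemma PR_subst:
  "\<exists>f. PR 2 (\<lambda>xs. f (xs ! 0) (xs ! 1)) \<and> (\<forall>p i. f \<ulcorner>p\<urcorner> i = \<ulcorner>subst p (num i)\<urcorner>)"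
proof -
  obtain s where s: "PR 2 (\<lambda>xs. s (xs ! 0) (xs ! 1))"
    "\<And>t i. s (gn_tm t) i = gn_tm (subst_tm t (num i))"
    using PR_subst_tm by blast
  define G where "G x y r1 r2 r3 =
    (if x mod 7 = 0 then Suc (7 * prod_encode (s (pfst (x div 7)) y, s (psnd (x div 7)) y))
     else if x mod 7 = 1 then Suc (7 * r3 + 1)
     else if x mod 7 \<le> 4 then Suc (7 * prod_encode (r1, r2) + x mod 7)
     else if pfst (x div 7) = 0 then Suc x
     else Suc (7 * prod_encode (pfst (x div 7), r2) + x mod 7))" for x y r1 r2 r3 :: nat
  have "\<exists>f. PR 2 (\<lambda>xs. f (xs ! 0) (xs ! 1)) \<and> (\<forall>y. f 0 y = 0) \<and>
    (\<forall>x y. f (Suc x) y = G x y (f (pfst (x div 7)) y) (f (psnd (x div 7)) y) (f (x div 7) y))"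
  proof (rule PR_course[where a = "\<lambda>x. pfst (x div 7)" and b = "\<lambda>x. psnd (x div 7)"
        and c = "\<lambda>x. x div 7" and G = G and g = "\<lambda>y. 0"])
    show "pfst (x div 7) \<le> x" "psnd (x div 7) \<le> x" "x div 7 \<le> x" for x
      using pfst_le[of "x div 7"] psnd_le[of "x div 7"] by linarith+
    show "PR 5 (\<lambda>xs. G (xs ! 0) (xs ! 1) (xs ! 2) (xs ! 3) (xs ! 4))"
      unfolding G_def by (intro pr_intro PR_comp2[OF s(1)]; simp)
  qed (intro pr_intro; simp)+
  then obtain f where f: "PR 2 (\<lambda>xs. f (xs ! 0) (xs ! 1))" "\<And>y. f 0 y = 0"
    "\<And>x y. f (Suc x) y = G x y (f (pfst (x div 7)) y) (f (psnd (x div 7)) y) (f (x div 7) y)"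
    by blast
  have step: "f (Suc (7 * m + r)) y =
    (if r = 0 then Suc (7 * prod_encode (s (pfst m) y, s (psnd m) y))
     else if r = 1 then Suc (7 * f m y + 1)
     else if r \<le> 4 then Suc (7 * prod_encode (f (pfst m) y, f (psnd m) y) + r)
     else if pfst m = 0 then Suc (7 * m + r)
     else Suc (7 * prod_encode (pfst m, f (psnd m) y) + r))" if "r < 7" for m r y
  proof -
    have "(7 * m + r) mod 7 = r" "(7 * m + r) div 7 = m" using that by simp_all
    then show ?thesis by (simp only: f(3) G_def)
  qed
  have "f (Suc (7 * m)) y = Suc (7 * prod_encode (s (pfst m) y, s (psnd m) y))"
      "f (Suc (7 * m + 1)) y = Suc (7 * f m y + 1)"
      "f (Suc (7 * m + 2)) y = Suc (7 * prod_encode (f (pfst m) y, f (psnd m) y) + 2)"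
      "f (Suc (7 * m + 3)) y = Suc (7 * prod_encode (f (pfst m) y, f (psnd m) y) + 3)"
      "f (Suc (7 * m + 4)) y = Suc (7 * prod_encode (f (pfst m) y, f (psnd m) y) + 4)"
      "f (Suc (7 * m + 5)) y = (if pfst m = 0 then Suc (7 * m + 5)
        else Suc (7 * prod_encode (pfst m, f (psnd m) y) + 5))"
      "f (Suc (7 * m + 6)) y = (if pfst m = 0 then Suc (7 * m + 6)
        else Suc (7 * prod_encode (pfst m, f (psnd m) y) + 6))" for m y
    using step[of 0] step[of 1] step[of 2] step[of 3] step[of 4] step[of 5] step[of 6] by simp_all
  note fs = this
  have "f \<ulcorner>p\<urcorner> i = \<ulcorner>subst p (num i)\<urcorner>" for p i
    by (induction p) (simp_all only: gn.simps subst.simps fs pfst_encode psnd_encode s(2) f(2), auto)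
  with f(1) show ?thesis by blast
qed

lemma PR_fv:
  "\<exists>f. PR 2 (\<lambda>xs. f (xs ! 0) (xs ! 1)) \<and> (\<forall>p y. f \<ulcorner>p\<urcorner> y = of_bool (y \<in> fv p))"
proof -
  obtain s where s: "PR 2 (\<lambda>xs. s (xs ! 0) (xs ! 1))"
    "\<And>t y. s (gn_tm t) y = of_bool (y \<in> fv_tm t)"
    using PR_fv_tm by blast
  define G where "G x y r1 r2 r3 =
    (if x mod 7 = 0 then if s (pfst (x div 7)) y = 0 then s (psnd (x div 7)) y else 1
     else if x mod 7 = 1 then r3
     else if x mod 7 \<le> 4 then if r1 = 0 then r2 else 1
     else if pfst (x div 7) = y then 0 else r2)" for x y r1 r2 r3 :: nat
  have "\<exists>f. PR 2 (\<lambda>xs. f (xs ! 0) (xs ! 1)) \<and> (\<forall>y. f 0 y = 0) \<and>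
    (\<forall>x y. f (Suc x) y = G x y (f (pfst (x div 7)) y) (f (psnd (x div 7)) y) (f (x div 7) y))"
  proof (rule PR_course[where a = "\<lambda>x. pfst (x div 7)" and b = "\<lambda>x. psnd (x div 7)"
        and c = "\<lambda>x. x div 7" and G = G and g = "\<lambda>y. 0"])
    show "pfst (x div 7) \<le> x" "psnd (x div 7) \<le> x" "x div 7 \<le> x" for x
      using pfst_le[of "x div 7"] psnd_le[of "x div 7"] by linarith+
    show "PR 5 (\<lambda>xs. G (xs ! 0) (xs ! 1) (xs ! 2) (xs ! 3) (xs ! 4))"
      unfolding G_def by (intro pr_intro PR_comp2[OF s(1)]; simp)
  qed (intro pr_intro; simp)+
  then obtain f where f: "PR 2 (\<lambda>xs. f (xs ! 0) (xs ! 1))" "\<And>y. f 0 y = 0"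
    "\<And>x y. f (Suc x) y = G x y (f (pfst (x div 7)) y) (f (psnd (x div 7)) y) (f (x div 7) y)"
    by blast
  have step: "f (Suc (7 * m + r)) y =
    (if r = 0 then if s (pfst m) y = 0 then s (psnd m) y else 1
     else if r = 1 then f m y
     else if r \<le> 4 then if f (pfst m) y = 0 then f (psnd m) y else 1
     else if pfst m = y then 0 else f (psnd m) y)" if "r < 7" for m r y
  proof -
    have "(7 * m + r) mod 7 = r" "(7 * m + r) div 7 = m" using that by simp_all
    then show ?thesis by (simp only: f(3) G_def)
  qed
  have "f (Suc (7 * m)) y = (if s (pfst m) y = 0 then s (psnd m) y else 1)"
      "f (Suc (7 * m + 1)) y = f m y"
      "f (Suc (7 * m + 2)) y = (if f (pfst m) y = 0 then f (psnd m) y else 1)"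
      "f (Suc (7 * m + 3)) y = (if f (pfst m) y = 0 then f (psnd m) y else 1)"
      "f (Suc (7 * m + 4)) y = (if f (pfst m) y = 0 then f (psnd m) y else 1)"
      "f (Suc (7 * m + 5)) y = (if pfst m = y then 0 else f (psnd m) y)"
      "f (Suc (7 * m + 6)) y = (if pfst m = y then 0 else f (psnd m) y)" for m y
    using step[of 0] step[of 1] step[of 2] step[of 3] step[of 4] step[of 5] step[of 6] by simp_all
  note fs = this
  have "f \<ulcorner>p\<urcorner> y = of_bool (y \<in> fv p)" for p y
    by (induction p) (simp_all only: gn.simps fv.simps fs pfst_encode psnd_encode s(2) f(2), auto)
  with f(1) show ?thesis by blast
qed

lemma list_encode_ge: "x \<in> set xs \<Longrightarrow> x \<le> list_encode xs"
proof (induction xs)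
  case (Cons a xs)
  have "a \<le> prod_encode (a, list_encode xs)" "list_encode xs \<le> prod_encode (a, list_encode xs)"
    by (rule le_prod_encode_1, rule le_prod_encode_2)
  with Cons show ?case by auto
qed simp

lemma fv_tm_le: "y \<in> fv_tm t \<Longrightarrow> y \<le> gn_tm t"
proof (induction t)
  case (Fn p ts)
  then obtain t where t: "t \<in> set ts" "y \<le> gn_tm t" by auto
  have "gn_tm t \<le> list_encode (map gn_tm ts)" using t(1) by (intro list_encode_ge) simp
  also have "\<dots> \<le> prod_encode (gn_pr p, list_encode (map gn_tm ts))" by (rule le_prod_encode_2)
  finally show ?case using t(2) by simp
qed simp

lemma fv_le: "y \<in> fv p \<Longrightarrow> y \<le> \<ulcorner>p\<urcorner>"
proof (induction p)
  case (Eq s t)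
  then show ?case
    using fv_tm_le[of y s] fv_tm_le[of y t] le_prod_encode_1[of "gn_tm s" "gn_tm t"]
      le_prod_encode_2[of "gn_tm t" "gn_tm s"] by auto
next
  case (And p q)
  then show ?case using le_prod_encode_1[of "\<ulcorner>p\<urcorner>" "\<ulcorner>q\<urcorner>"] le_prod_encode_2[of "\<ulcorner>q\<urcorner>" "\<ulcorner>p\<urcorner>"] by auto
next
  case (Or p q)
  then show ?case using le_prod_encode_1[of "\<ulcorner>p\<urcorner>" "\<ulcorner>q\<urcorner>"] le_prod_encode_2[of "\<ulcorner>q\<urcorner>" "\<ulcorner>p\<urcorner>"] by auto
next
  case (Imp p q)
  then show ?case using le_prod_encode_1[of "\<ulcorner>p\<urcorner>" "\<ulcorner>q\<urcorner>"] le_prod_encode_2[of "\<ulcorner>q\<urcorner>" "\<ulcorner>p\<urcorner>"] by auto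
next
  case (All x p)
  then show ?case using le_prod_encode_2[of "\<ulcorner>p\<urcorner>" x] by auto
next
  case (Ex x p)
  then show ?case using le_prod_encode_2[of "\<ulcorner>p\<urcorner>" x] by auto
qed auto

lemma d_primrec: "\<exists>p. \<forall>x. pev p [x] = d x"
proof -
  obtain s where s: "PR 2 (\<lambda>xs. s (xs ! 0) (xs ! 1))" "\<And>p i. s \<ulcorner>p\<urcorner> i = \<ulcorner>subst p (num i)\<urcorner>"
    using PR_subst by blast
  obtain w where w: "PR 2 (\<lambda>xs. w (xs ! 0) (xs ! 1))" "\<And>p y. w \<ulcorner>p\<urcorner> y = of_bool (y \<in> fv p)"
    using PR_fv by blast
  define h where "h k r x = (if w x (Suc k) = 0 then r else 1)" for k r x :: nat
  define A where "A k x = rec_nat 0 (\<lambda>k r. h k r x) k" for k x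
  have PRA: "PR 2 (\<lambda>xs. A (xs ! 0) (xs ! 1))"
  proof (rule PR_rec[where f = "\<lambda>x y. A (x) (y)" and g = "\<lambda>y. 0" and h = h])
    show "PR 3 (\<lambda>xs. h (xs ! 0) (xs ! 1) (xs ! 2))"
      unfolding h_def by (intro pr_intro PR_comp2[OF w(1)]; simp)
  qed (auto simp: A_def PR_const)
  have *: "PR 1 (\<lambda>xs. if A (xs ! 0) (xs ! 0) = 0 then s (xs ! 0) (xs ! 0) else 0)"
    by (intro pr_intro PR_comp2[OF s(1)] PR_comp2[OF PRA]) simp_all
  have A: "A k x = 0 \<longleftrightarrow> (\<forall>y\<le>k. y \<noteq> 0 \<longrightarrow> w x y = 0)" for k x
  proof (induction k)
    case 0 then show ?case by (simp add: A_def)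
  next
    case (Suc k)
    have "A (Suc k) x = (if w x (Suc k) = 0 then A k x else 1)"
      by (simp add: A_def h_def)
    then show ?case using Suc le_Suc_eq by (metis One_nat_def nat.distinct(1) order_refl)
  qed
  have "(if A x x = 0 then s x x else 0) = d x" for x
  proof -
    have "A x x = 0 \<longleftrightarrow> (\<forall>y\<le>x. y \<noteq> 0 \<longrightarrow> y \<notin> fv (\<phi> x))"
      unfolding A using w(2)[of "\<phi> x"] by auto
    also have "\<dots> \<longleftrightarrow> x \<in> \<Gamma>"
      unfolding \<Gamma>_iff v_formula_def using fv_le[of _ "\<phi> x"] by auto
    finally show ?thesis using s(2)[of "\<phi> x"] by (simp add: d_def)
  qed
  with * obtain p where p: "\<And>xs. length xs = 1 \<Longrightarrow> pev p xs = d (xs ! 0)"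
    unfolding PR_def by auto
  have "pev p [x] = d x" for x using p[of "[x]"] by simp
  then show ?thesis by blast
qed

definition d_sym :: pr where
  "d_sym = (SOME p. \<forall>x. pev p [x] = d x)"

lemma pev_d_sym: "pev d_sym [x] = d x"
  using someI_ex[OF d_primrec] unfolding d_sym_def by blast


section \<open>Smullyan models\<close>

record 'a smullyan_model =
  alphabet :: "'a set"
  predicates :: "'a list set"
  Phi :: "'a list \<Rightarrow> 'a list set"

definition sent_of :: "'a set \<Rightarrow> 'a list set \<Rightarrow> 'a list set" where
  "sent_of \<Sigma> P = {H @ X | H X. H \<in> P \<and> X \<in> lists \<Sigma>}"

definition True_of :: "'a smullyan_model \<Rightarrow> 'a list set" where
  "True_of M = {H @ X | H X. H \<in> predicates M \<and> X \<in> Phi M H}"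

definition FPT :: "'a smullyan_model \<Rightarrow> bool" where
  "FPT M \<longleftrightarrow> (\<forall>H \<in> predicates M.
     \<exists>S \<in> sent_of (alphabet M) (predicates M) - predicates M.
       S \<in> True_of M \<longleftrightarrow> H @ S \<in> True_of M)"


section \<open>The model based on the natural numbers\<close>

text \<open>\<open>SN\<close>, \<open>SR\<close> are the symbols \<open>n\<close>, \<open>r\<close>, and \<open>SA i\<close> is \<open>a\<^sub>i\<close>.\<close>

datatype sym = SN | SR | SA nat

definition \<Sigma> :: "sym set" where
  "\<Sigma> = {SA i | i. i \<in> \<Gamma>} \<union> {SN, SR}"

definition Pred :: "sym list set" where
  "Pred = {X @ [SA i] | X i. X \<in> lists {SN, SR} \<and> i \<in> \<Gamma>}"

definition Sent :: "sym list set" where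
  "Sent = sent_of \<Sigma> Pred"

definition Sent_plus :: "sym list set" where
  "Sent_plus = Sent - Pred"

text \<open>
  \<open>I_r\<close> is the part of \<open>I\<close> that follows the first \<open>r\<close>; the closed forms are \<open>I_eq1\<close>, \<open>I_eq2\<close>,
  \<open>I_eq3\<close> below. The values outside \<^const>\<open>Pred\<close> are irrelevant.
\<close>

fun I_r :: "sym list \<Rightarrow> fm" where
  "I_r (SA i # _) = subst (\<phi> i) (Fn d_sym [Var v])"
| "I_r (SN # X) = Neg (I_r X)"
| "I_r (SR # _) = Bot"
| "I_r [] = Bot"

fun I :: "sym list \<Rightarrow> fm" where
  "I (SA i # _) = \<phi> i"
| "I (SN # X) = Neg (I X)"
| "I (SR # X) = I_r X"
| "I [] = Bot"

lemma I_eq1: "I (replicate k SN @ [SA i]) = (Neg ^^ k) (\<phi> i)"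
  by (induction k) auto

lemma I_r_eq: "I_r (replicate l SN @ [SA i]) = (Neg ^^ l) (subst (\<phi> i) (Fn d_sym [Var v]))"
  by (induction l) auto

lemma I_eq2: "I (replicate k SN @ [SR] @ replicate l SN @ [SA i]) =
    (Neg ^^ (k + l)) (subst (\<phi> i) (Fn d_sym [Var v]))"
  by (induction k) (auto simp: I_r_eq)

lemma I_r_eq2: "I_r (replicate l SN @ [SR] @ Y) = (Neg ^^ l) Bot"
  by (induction l) auto

lemma I_eq3: "I (replicate k SN @ [SR] @ replicate l SN @ [SR] @ Y @ [SA i]) =
    (Neg ^^ (k + l)) Bot"
  using I_r_eq2[of l "Y @ [SA i]"] by (induction k) auto

text \<open>
  The unique decomposition of a string of \<^const>\<open>Sent\<close> into an element of \<^const>\<open>Pred\<close> and the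
  remaining string: the head extends to the first symbol \<open>SA i\<close>.
\<close>

fun split_sent :: "sym list \<Rightarrow> sym list \<times> sym list" where
  "split_sent [] = ([], [])"
| "split_sent (SA i # X) = ([SA i], X)"
| "split_sent (SN # X) = (case split_sent X of (H, Y) \<Rightarrow> (SN # H, Y))"
| "split_sent (SR # X) = (case split_sent X of (H, Y) \<Rightarrow> (SR # H, Y))"

lemma split_sent_append:
  assumes "H \<in> Pred"
  shows "split_sent (H @ X) = (H, X)"
proof -
  have "split_sent ((Y @ [SA i]) @ X) = (Y @ [SA i], X)" if "Y \<in> lists {SN, SR}" for Y i
    using that by (induction Y) auto
  with assms show ?thesis unfolding Pred_def by blast
qed

lemma decomposition_unique:
  "H \<in> Pred \<Longrightarrow> H' \<in> Pred \<Longrightarrow> H @ X = H' @ X' \<Longrightarrow> H = H' \<and> X = X'"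
  by (metis split_sent_append prod.inject)

lemma split_sent_concat: "split_sent Z = (H, X) \<Longrightarrow> Z = H @ X"
  by (induction Z arbitrary: H X rule: split_sent.induct) (auto split: prod.splits)

text \<open>
  \<open>J\<close>, by recursion on the string; the defining clauses for strings \<open>HX\<close> are \<open>J_Pred\<close>, \<open>J_a\<close>,
  \<open>J_r\<close>, \<open>J_n\<close> below. The values outside \<^const>\<open>Sent\<close> are irrelevant.
\<close>

function J :: "sym list \<Rightarrow> fm" where
  "J Z = (let (H, X) = split_sent Z in
     if X \<in> Pred then subst (I H) (num \<ulcorner>I X\<urcorner>)
     else (case Z of
         SA i # _ \<Rightarrow> (if X \<in> Sent then subst (I [SA i]) (num \<ulcorner>J X\<urcorner>) else subst (I [SA i]) Zero)
       | SR # _ \<Rightarrow> Bot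
       | SN # Z' \<Rightarrow> Neg (J Z')
       | [] \<Rightarrow> Bot))"
  by pat_completeness auto
termination
  by (relation "measure length") simp_all

declare J.simps [simp del]

lemma J_Pred: "H \<in> Pred \<Longrightarrow> X \<in> Pred \<Longrightarrow> J (H @ X) = subst (I H) (num \<ulcorner>I X\<urcorner>)"
  by (simp add: J.simps[of "H @ X"] split_sent_append)

lemma Pred_subset_Sent: "Pred \<subseteq> Sent"
proof
  fix H assume "H \<in> Pred"
  then have "H = H @ []" "H \<in> Pred" "[] \<in> lists \<Sigma>" by simp_all
  then show "H \<in> Sent" unfolding Sent_def sent_of_def by blast
qed

lemma J_a:
  "X \<notin> Sent \<Longrightarrow> J ([SA i] @ X) = subst (I [SA i]) Zero"
  "X \<in> Sent_plus \<Longrightarrow> J ([SA i] @ X) = subst (I [SA i]) (num \<ulcorner>J X\<urcorner>)"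
proof -
  have *: "J ([SA i] @ X) = (if X \<in> Sent then subst (I [SA i]) (num \<ulcorner>J X\<urcorner>)
      else subst (I [SA i]) Zero)" if "X \<notin> Pred"
    using that by (subst J.simps) simp
  show "X \<notin> Sent \<Longrightarrow> J ([SA i] @ X) = subst (I [SA i]) Zero"
    using * Pred_subset_Sent by (metis subsetD)
  show "X \<in> Sent_plus \<Longrightarrow> J ([SA i] @ X) = subst (I [SA i]) (num \<ulcorner>J X\<urcorner>)"
    using * unfolding Sent_plus_def by (metis DiffD1 DiffD2)
qed

lemma J_r: "H \<in> Pred \<Longrightarrow> X \<notin> Pred \<Longrightarrow> J ([SR] @ H @ X) = Bot"
  by (simp add: J.simps[of "SR # H @ X"] split_sent_append)

lemma J_n: "H \<in> Pred \<Longrightarrow> X \<notin> Pred \<Longrightarrow> J ([SN] @ H @ X) = Neg (J (H @ X))"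
  by (simp add: J.simps[of "SN # H @ X"] split_sent_append)

definition M_N :: "sym smullyan_model" where
  "M_N = \<lparr>alphabet = \<Sigma>, predicates = Pred,
     Phi = (\<lambda>H. {X \<in> lists \<Sigma>. \<nat> \<Turnstile> J (H @ X)})\<rparr>"

lemma Sent_plus_M_N: "sent_of (alphabet M_N) (predicates M_N) - predicates M_N = Sent_plus"
  by (simp add: M_N_def Sent_plus_def Sent_def)

end

theory Submission
  imports Defs
begin

text \<open>
  Apply FPT to the predicate \<open>a\<^sub>i\<close>. For the resulting \<open>S\<close>, which lies in \<^const>\<open>Sent_plus\<close>, the
  string \<open>a\<^sub>i S\<close> is interpreted by \<open>J\<close> as \<open>\<phi>\<^sub>i\<close> applied to the number of \<open>J S\<close>, so \<open>J S\<close> itself is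
  the required sentence.
\<close>

lemma tval_cong: "(\<And>x. x \<in> fv_tm t \<Longrightarrow> e x = e' x) \<Longrightarrow> tval e t = tval e' t"
proof (induction t)
  case (Fn p ts)
  then have "map (tval e) ts = map (tval e') ts" by (intro map_cong) auto
  then show ?case by (simp only: tval.simps)
qed simp

text \<open>The quantifier cases update both assignments, so the induction generalises over them.
  The purpose is that a sentence has the same truth value under every assignment.\<close>

lemma sat_cong: "(\<And>x. x \<in> fv p \<Longrightarrow> e x = e' x) \<Longrightarrow> sat e p \<longleftrightarrow> sat e' p"
proof (induction p arbitrary: e e')
  case (Eq s t)
  then have "tval e s = tval e' s" "tval e t = tval e' t" by (auto intro!: tval_cong)
  then show ?case by simp
next
  case (Neg p)
  have "sat e p \<longleftrightarrow> sat e' p" by (rule Neg.IH) (use Neg.prems in simp)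
  then show ?case by simp
next
  case (And p q)
  have "sat e p \<longleftrightarrow> sat e' p" "sat e q \<longleftrightarrow> sat e' q"
    by (rule And.IH; use And.prems in simp)+
  then show ?case by simp
next
  case (Or p q)
  have "sat e p \<longleftrightarrow> sat e' p" "sat e q \<longleftrightarrow> sat e' q"
    by (rule Or.IH; use Or.prems in simp)+
  then show ?case by simp
next
  case (Imp p q)
  have "sat e p \<longleftrightarrow> sat e' p" "sat e q \<longleftrightarrow> sat e' q"
    by (rule Imp.IH; use Imp.prems in simp)+
  then show ?case by simp
next
  case (All x p)
  have "sat (e(x := n)) p \<longleftrightarrow> sat (e'(x := n)) p" for n
    by (rule All.IH) (use All.prems in simp)
  then show ?case by simp
next
  case (Ex x p)
  have "sat (e(x := n)) p \<longleftrightarrow> sat (e'(x := n)) p" for n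
    by (rule Ex.IH) (use Ex.prems in simp)
  then show ?case by simp
qed simp

text \<open>Truth in the standard model quantifies over all assignments, so it need not commute with
  connectives on open formulas. For sentences the truth values \<open>P\<close> and \<open>Q\<close>
  are constant, and it does.\<close>

lemma true_N_Iff:
  assumes "sentence p" "sentence q"
  shows "\<nat> \<Turnstile> Iff p q \<longleftrightarrow> (\<nat> \<Turnstile> p \<longleftrightarrow> \<nat> \<Turnstile> q)"
proof -
  obtain P Q where "\<And>e. sat e p = P" "\<And>e. sat e q = Q"
    using assms sat_cong unfolding sentence_def by (metis empty_iff)
  then show ?thesis by (auto simp: true_N_def)
qed

lemma fv_subst_tm: "fv_tm (subst_tm s t) \<subseteq> (fv_tm s - {v}) \<union> fv_tm t"
  by (induction s) auto

lemma fv_subst: "fv (subst p t) \<subseteq> (fv p - {v}) \<union> fv_tm t"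
proof (induction p)
  case (Eq r s)
  then show ?case using fv_subst_tm[of r t] fv_subst_tm[of s t] by auto
qed auto

lemma fv_num: "fv_tm (num n) = {}"
  by (induction n) (auto simp: Zero_def)

lemma sentence_subst: "v_formula p \<Longrightarrow> fv_tm t = {} \<Longrightarrow> sentence (subst p t)"
  using fv_subst[of p t] by (auto simp: v_formula_def sentence_def)

lemma singleton_in_Pred: "i \<in> \<Gamma> \<Longrightarrow> [SA i] \<in> Pred"
  unfolding Pred_def by force

text \<open>\<open>Pred_def\<close> exhibits the last symbol of a predicate, whereas
  \<open>I\<close>, \<open>I_r\<close> and \<open>J\<close> consume strings from the left. Building
  predicates by prefixing \<open>SN\<close> and \<open>SR\<close> matches these recursions.\<close>

lemma Pred_induct [consumes 1, case_names a n r]: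
  assumes "H \<in> Pred"
    and a: "\<And>i. i \<in> \<Gamma> \<Longrightarrow> P [SA i]"
    and n: "\<And>H. H \<in> Pred \<Longrightarrow> P H \<Longrightarrow> P (SN # H)"
    and r: "\<And>H. H \<in> Pred \<Longrightarrow> P H \<Longrightarrow> P (SR # H)"
  shows "P H"
proof -
  obtain X i where H: "H = X @ [SA i]" "X \<in> lists {SN, SR}" "i \<in> \<Gamma>"
    using assms(1) unfolding Pred_def by blast
  have "P (X @ [SA i])" using H(2)
  proof (induction X)
    case Nil
    then show ?case using a H(3) by simp
  next
    case (Cons x X)
    then have "X @ [SA i] \<in> Pred" using H(3) unfolding Pred_def by auto
    then show ?case using Cons n r by auto
  qed
  then show ?thesis using H(1) by simp
qed

lemma v_formula_I_r: "H \<in> Pred \<Longrightarrow> v_formula (I_r H)"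
proof (induction rule: Pred_induct)
  case (a i)
  then show ?case
    using fv_subst[of "\<phi> i" "Fn d_sym [Var v]"] by (auto simp: \<Gamma>_iff v_formula_def)
qed (simp_all add: v_formula_def)

lemma v_formula_I: "H \<in> Pred \<Longrightarrow> v_formula (I H)"
proof (induction rule: Pred_induct)
  case (r H)
  then show ?case using v_formula_I_r[of H] by (simp add: v_formula_def)
qed (simp_all add: \<Gamma>_iff v_formula_def)

text \<open>Outside \<open>Pred\<close>, induction on \<open>H\<close> alone suffices:
  \<open>J X\<close> enters \<open>J (SA i # X)\<close> only through its numeral, which is a closed
  term whatever \<open>J X\<close> is.\<close>

lemma sentence_J:
  assumes "H \<in> Pred"
  shows "sentence (J (H @ X))"
proof (cases "X \<in> Pred")
  case True
  then show ?thesis using assms by (simp add: J_Pred sentence_subst v_formula_I fv_num)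
next
  case False
  from assms show ?thesis
  proof (induction rule: Pred_induct)
    case (a i)
    then have i: "v_formula (I [SA i])" by (intro v_formula_I singleton_in_Pred)
    \<comment> \<open>Both clauses of \<open>J_a\<close> substitute a numeral, the default
      \<open>Zero\<close> being \<open>num 0\<close>.\<close>
    have "J ([SA i] @ X) = subst (I [SA i]) (num 0) \<or>
        J ([SA i] @ X) = subst (I [SA i]) (num \<ulcorner>J X\<urcorner>)"
      using False J_a[of X i] by (auto simp: Sent_plus_def)
    then show ?case using sentence_subst[OF i fv_num] by metis
  next
    case (n H)
    then show ?case using J_n[of H X] False by (simp add: sentence_def)
  next
    case (r H)
    then show ?case using J_r[of H X] False by (simp add: sentence_def)
  qed
qed

text \<open>\<open>J\<close> depends only on the concatenated string, so any decomposition
  witnessing membership in \<open>True_of M_N\<close> yields the same truth condition.\<close>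

lemma True_of_M_N_iff:
  assumes "H \<in> Pred" "X \<in> lists \<Sigma>"
  shows "H @ X \<in> True_of M_N \<longleftrightarrow> \<nat> \<Turnstile> J (H @ X)"
proof
  assume "H @ X \<in> True_of M_N"
  then obtain H' X' where "H @ X = H' @ X'" "\<nat> \<Turnstile> J (H' @ X')"
    unfolding True_of_def M_N_def by auto
  then show "\<nat> \<Turnstile> J (H @ X)" by metis
next
  assume "\<nat> \<Turnstile> J (H @ X)"
  then show "H @ X \<in> True_of M_N" using assms unfolding True_of_def M_N_def by auto
qed

lemma Pred_subset_lists: "Pred \<subseteq> lists \<Sigma>"
  unfolding Pred_def \<Sigma>_def by auto

theorem theorem5p10:
  assumes "FPT M_N"
  shows "\<forall>i \<in> \<Gamma>. \<exists>\<theta>. sentence \<theta> \<and> \<nat> \<Turnstile> Iff \<theta> (subst (\<phi> i) (num \<ulcorner>\<theta>\<urcorner>))"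
proof
  fix i assume i: "i \<in> \<Gamma>"
  then have a: "[SA i] \<in> Pred" by (rule singleton_in_Pred)
  then have "[SA i] \<in> predicates M_N" by (simp add: M_N_def)
  with assms obtain S where S: "S \<in> Sent_plus"
    "S \<in> True_of M_N \<longleftrightarrow> [SA i] @ S \<in> True_of M_N"
    unfolding FPT_def Sent_plus_M_N by blast
  \<comment> \<open>The splitting makes the truth characterisation applicable to \<open>S\<close>
    itself. It also shows that \<open>S\<close> is a string over the alphabet, as required when
    \<open>S\<close> is the argument of \<open>[SA i]\<close>.\<close>
  then obtain H X where HX: "S = H @ X" "H \<in> Pred" "X \<in> lists \<Sigma>"
    unfolding Sent_plus_def Sent_def sent_of_def by blast
  then have "S \<in> lists \<Sigma>" using Pred_subset_lists by auto
  then have "\<nat> \<Turnstile> J S \<longleftrightarrow> \<nat> \<Turnstile> J ([SA i] @ S)"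
    using S(2) True_of_M_N_iff[OF a] True_of_M_N_iff[OF HX(2,3)] HX(1) by simp
  \<comment> \<open>Here it matters that \<open>S\<close> is outside \<open>Pred\<close>: for a
    predicate the substituted numeral would code \<open>I S\<close> instead of
    \<open>J S\<close>.\<close>
  moreover have "J ([SA i] @ S) = subst (\<phi> i) (num \<ulcorner>J S\<urcorner>)"
    using J_a(2)[OF S(1)] by simp
  moreover have "sentence (J S)" using sentence_J HX by simp
  moreover have "sentence (subst (\<phi> i) (num \<ulcorner>J S\<urcorner>))"
    using i by (simp add: \<Gamma>_iff sentence_subst fv_num)
  ultimately show "\<exists>\<theta>. sentence \<theta> \<and> \<nat> \<Turnstile> Iff \<theta> (subst (\<phi> i) (num \<ulcorner>\<theta>\<urcorner>))"
    by (intro exI[of _ "J S"]) (simp add: true_N_Iff)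
qed

end
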